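(* Each of the following four dimensional real Lie algebras admits generalized complex structures of type $1$ and of type $2$, but not of type $0$: $\mathbb R\times\mathfrak r_{3,1}$, $\mathfrak r_{4,1}$, $\mathfrak r'_{4,\mu,\lambda}$ $(\mu>0,\ \lambda\neq0)$, $\mathbb R\times\mathfrak r'_{3,\lambda}$ $(\lambda\neq0)$, $\mathfrak r_{4,\mu,\mu}$ $(-1<\mu\le1,\ \mu\neq0)$, $\mathfrak r_{4,\mu,1}$ $(-1<\mu\le1,\ \mu\neq0)$, and $\mathfrak d'_{4,0}$.
   Context: The parameters $\lambda,\mu$ are real. The Lie algebras have basis $e_0,e_1,e_2,e_3$ and the following nonzero brackets (up to skew-symmetry): $\mathbb R\times\mathfrak r_{3,1}$: $[e_1,e_2]=e_2$, $[e_1,e_3]=e_3$. $\mathfrak r_{4,1}$: $[e_0,e_1]=e_1$, $[e_0,e_2]=e_2$, $[e_0,e_3]=e_2+e_3$. $\mathfrak r'_{4,\mu,\lambda}$: $[e_0,e_1]=\mu e_1$, $[e_0,e_2]=\lambda e_2-e_3$, $[e_0,e_3]=e_2+\lambda e_3$. $\mathbb R\times\mathfrak r'_{3,\lambda}$: $[e_1,e_2]=\lambda e_2-e_3$, $[e_1,e_3]=e_2+\lambda e_3$. $\mathfrak r_{4,\mu,\lambda}$: $[e_0,e_1]=e_1$, $[e_0,e_2]=\mu e_2$, $[e_0,e_3]=\lambda e_3$. $\mathfrak d'_{4,0}$: $[e_0,e_1]=-e_2$, $[e_0,e_2]=e_1$, $[e_1,e_2]=e_3$. A generalized complex structure on a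 real Lie algebra $\mathfrak g$ is an endomorphism $\mathcal J$ of $\mathfrak g\oplus\mathfrak g^*$ with $\mathcal J^2=-\mathrm{Id}$, orthogonal with respect to $\langle (x,\alpha),(y,\beta)\rangle=\frac12(\beta(x)+\alpha(y))$, and satisfying $[u,v]+\mathcal J[\mathcal Ju,v]+\mathcal J[u,\mathcal Jv]-[\mathcal Ju,\mathcal Jv]=0$ for all $u,v\in\mathfrak g\oplus\mathfrak g^*$, where $[(x,\alpha),(y,\beta)]=([x,y],-\beta\circ\mathrm{ad}(x)+\alpha\circ\mathrm{ad}(y))$. Write $\mathcal J=\begin{pmatrix}\mathcal J_1&\mathcal J_2\\ \mathcal J_3&\mathcal J_4\end{pmatrix}$ with respect to $\mathfrak g\oplus\mathfrak g^*$, so $\mathcal J_2:\mathfrak g^*\to\mathfrak g$. If $\dim\mathfrak g=2n$, $\mathcal J$ is of type $k$ when $\operatorname{rank}(\mathcal J_2)=2(n-k)$. *)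

theory Defs
  imports "HOL-Analysis.Analysis"
begin

section \<open>Lie brackets and generalized complex structures\<close>

definition lie_bracket :: "('a::real_vector \<Rightarrow> 'a \<Rightarrow> 'a) \<Rightarrow> bool" where
  "lie_bracket br \<longleftrightarrow> bilinear br \<and> (\<forall>x. br x x = 0) \<and>
     (\<forall>x y z. br x (br y z) + br y (br z x) + br z (br x y) = 0)"

text \<open>The dual space is the type of bounded linear functionals; on a Euclidean space every
  linear functional is bounded, so this is the full algebraic dual.\<close>

type_synonym 'a double = "'a \<times> ('a \<Rightarrow>\<^sub>L real)"

definition pairing :: "'a::euclidean_space double \<Rightarrow> 'a double \<Rightarrow> real" where
  "pairing = (\<lambda>(x, \<alpha>) (y, \<beta>). (blinfun_apply \<beta> x + blinfun_apply \<alpha> y) / 2)"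

text \<open>\<^const>\<open>Blinfun\<close> is meaningful only on bounded linear maps; for a bilinear bracket on a
  Euclidean space this is satisfied, see \<open>blinfun_apply_ad\<close>.\<close>

definition ad :: "('a \<Rightarrow> 'a \<Rightarrow> 'a) \<Rightarrow> 'a::euclidean_space \<Rightarrow> 'a \<Rightarrow>\<^sub>L 'a" where
  "ad br x = Blinfun (br x)"

lemma blinfun_apply_ad: "bilinear br \<Longrightarrow> blinfun_apply (ad br x) = br x"
  unfolding ad_def bilinear_def by (simp add: bounded_linear_Blinfun_apply linear_conv_bounded_linear)

definition double_bracket ::
    "('a \<Rightarrow> 'a \<Rightarrow> 'a) \<Rightarrow> 'a::euclidean_space double \<Rightarrow> 'a double \<Rightarrow> 'a double" where
  "double_bracket br = (\<lambda>(x, \<alpha>) (y, \<beta>). (br x y, - (\<beta> o\<^sub>L ad br x) + (\<alpha> o\<^sub>L ad br y)))"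

definition generalized_complex_structure ::
    "('a \<Rightarrow> 'a \<Rightarrow> 'a) \<Rightarrow> ('a::euclidean_space double \<Rightarrow> 'a double) \<Rightarrow> bool" where
  "generalized_complex_structure br J \<longleftrightarrow>
     linear J \<and>
     (\<forall>u. J (J u) = - u) \<and>
     (\<forall>u v. pairing (J u) (J v) = pairing u v) \<and>
     (\<forall>u v. double_bracket br u v + J (double_bracket br (J u) v)
          + J (double_bracket br u (J v)) - double_bracket br (J u) (J v) = 0)"

definition block2 :: "('a::euclidean_space double \<Rightarrow> 'a double) \<Rightarrow> ('a \<Rightarrow>\<^sub>L real) \<Rightarrow> 'a" where
  "block2 J \<alpha> = fst (J (0, \<alpha>))"

text \<open>Integers avoid the truncated subtraction of natural numbers when \<open>k > n\<close>.\<close>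

definition has_type :: "('a::euclidean_space double \<Rightarrow> 'a double) \<Rightarrow> nat \<Rightarrow> bool" where
  "has_type J k \<longleftrightarrow>
     (\<exists>n. DIM('a) = 2 * n \<and> int (dim (range (block2 J))) = 2 * (int n - int k))"

definition admits_gcs_of_type :: "('a::euclidean_space \<Rightarrow> 'a \<Rightarrow> 'a) \<Rightarrow> nat \<Rightarrow> bool" where
  "admits_gcs_of_type br k \<longleftrightarrow> (\<exists>J. generalized_complex_structure br J \<and> has_type J k)"


section \<open>The four dimensional Lie algebras\<close>

text \<open>The index type \<^typ>\<open>4\<close> has the elements 0, 1, 2, 3.\<close>

abbreviation \<ee> :: "4 \<Rightarrow> real^4" where
  "\<ee> i \<equiv> axis i 1"

text \<open>A table \<open>c\<close> lists each nonzero bracket once, \<open>c i j\<close> being the listed value of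
  \<open>[\<ee> i, \<ee> j]\<close>, and is 0 for all other pairs; the bracket is its skew-symmetric bilinear
  extension.\<close>

definition bracket_of :: "(4 \<Rightarrow> 4 \<Rightarrow> real^4) \<Rightarrow> real^4 \<Rightarrow> real^4 \<Rightarrow> real^4" where
  "bracket_of c x y = (\<Sum>i\<in>UNIV. \<Sum>j\<in>UNIV. (x $ i * y $ j) *\<^sub>R (c i j - c j i))"

definition R_r31 :: "real^4 \<Rightarrow> real^4 \<Rightarrow> real^4" where
  "R_r31 = bracket_of (\<lambda>i j.
     if (i, j) = (1, 2) then \<ee> 2 else
     if (i, j) = (1, 3) then \<ee> 3 else 0)"

definition r41 :: "real^4 \<Rightarrow> real^4 \<Rightarrow> real^4" where
  "r41 = bracket_of (\<lambda>i j.
     if (i, j) = (0, 1) then \<ee> 1 else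
     if (i, j) = (0, 2) then \<ee> 2 else
     if (i, j) = (0, 3) then \<ee> 2 + \<ee> 3 else 0)"

definition r4' :: "real \<Rightarrow> real \<Rightarrow> real^4 \<Rightarrow> real^4 \<Rightarrow> real^4" where
  "r4' \<mu> lam = bracket_of (\<lambda>i j.
     if (i, j) = (0, 1) then \<mu> *\<^sub>R \<ee> 1 else
     if (i, j) = (0, 2) then lam *\<^sub>R \<ee> 2 - \<ee> 3 else
     if (i, j) = (0, 3) then \<ee> 2 + lam *\<^sub>R \<ee> 3 else 0)"

definition R_r3' :: "real \<Rightarrow> real^4 \<Rightarrow> real^4 \<Rightarrow> real^4" where
  "R_r3' lam = bracket_of (\<lambda>i j.
     if (i, j) = (1, 2) then lam *\<^sub>R \<ee> 2 - \<ee> 3 else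
     if (i, j) = (1, 3) then \<ee> 2 + lam *\<^sub>R \<ee> 3 else 0)"

definition r4 :: "real \<Rightarrow> real \<Rightarrow> real^4 \<Rightarrow> real^4 \<Rightarrow> real^4" where
  "r4 \<mu> lam = bracket_of (\<lambda>i j.
     if (i, j) = (0, 1) then \<ee> 1 else
     if (i, j) = (0, 2) then \<mu> *\<^sub>R \<ee> 2 else
     if (i, j) = (0, 3) then lam *\<^sub>R \<ee> 3 else 0)"

definition d4'0 :: "real^4 \<Rightarrow> real^4 \<Rightarrow> real^4" where
  "d4'0 = bracket_of (\<lambda>i j.
     if (i, j) = (0, 1) then - \<ee> 2 else
     if (i, j) = (0, 2) then \<ee> 1 else
     if (i, j) = (1, 2) then \<ee> 3 else 0)"

lemma four_eq_zero: "(4::4) = 0"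
  by simp

lemma all_index: "(\<forall>i::4. P i) \<longleftrightarrow> P 0 \<and> P 1 \<and> P 2 \<and> P 3"
  unfolding forall_4 four_eq_zero by blast

lemma sum_index: "(\<Sum>i\<in>UNIV. f i) = f 0 + f 1 + f 2 + f (3::4)"
  for f :: "4 \<Rightarrow> 'b::comm_monoid_add"
  unfolding sum_4 four_eq_zero by (simp add: ac_simps)

lemma bilinear_bracket_of: "bilinear (bracket_of c)"
  unfolding bilinear_def bracket_of_def
  by (auto intro!: linearI simp: scaleR_add_left scaleR_sum_right distrib_left distrib_right
      sum.distrib mult_ac)

lemma bracket_of_basis: "bracket_of c (\<ee> i) (\<ee> j) = c i j - c j i"
proof -
  have "bracket_of c (\<ee> i) (\<ee> j) =
     (\<Sum>k\<in>UNIV. \<Sum>l\<in>UNIV. if l = j then if k = i then c i j - c j i else 0 else 0)"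
    unfolding bracket_of_def by (intro sum.cong refl) (auto simp: axis_def)
  then show ?thesis by simp
qed

lemma bracket_of_nth:
  "bracket_of c x y $ k =
     (x $ 0 * y $ 1 - x $ 1 * y $ 0) * (c 0 1 $ k - c 1 0 $ k) +
     (x $ 0 * y $ 2 - x $ 2 * y $ 0) * (c 0 2 $ k - c 2 0 $ k) +
     (x $ 0 * y $ 3 - x $ 3 * y $ 0) * (c 0 3 $ k - c 3 0 $ k) +
     (x $ 1 * y $ 2 - x $ 2 * y $ 1) * (c 1 2 $ k - c 2 1 $ k) +
     (x $ 1 * y $ 3 - x $ 3 * y $ 1) * (c 1 3 $ k - c 3 1 $ k) +
     (x $ 2 * y $ 3 - x $ 3 * y $ 2) * (c 2 3 $ k - c 3 2 $ k)"
  unfolding bracket_of_def sum_index vector_add_component vector_scaleR_component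
    vector_minus_component real_scaleR_def
  by algebra

lemma bracket_of_refl: "bracket_of c x x = 0"
  by (simp add: vec_eq_iff bracket_of_nth)

lemma R_r31_nth:
  "R_r31 x y $ 0 = 0"
  "R_r31 x y $ 1 = 0"
  "R_r31 x y $ 2 = x $ 1 * y $ 2 - x $ 2 * y $ 1"
  "R_r31 x y $ 3 = x $ 1 * y $ 3 - x $ 3 * y $ 1"
  by (simp_all add: R_r31_def bracket_of_nth axis_def)

lemma r41_nth:
  "r41 x y $ 0 = 0"
  "r41 x y $ 1 = x $ 0 * y $ 1 - x $ 1 * y $ 0"
  "r41 x y $ 2 = x $ 0 * y $ 2 - x $ 2 * y $ 0 + x $ 0 * y $ 3 - x $ 3 * y $ 0"
  "r41 x y $ 3 = x $ 0 * y $ 3 - x $ 3 * y $ 0"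
  by (simp_all add: r41_def bracket_of_nth axis_def)

lemma r4'_nth:
  "r4' \<mu> lam x y $ 0 = 0"
  "r4' \<mu> lam x y $ 1 = \<mu> * (x $ 0 * y $ 1 - x $ 1 * y $ 0)"
  "r4' \<mu> lam x y $ 2 = lam * (x $ 0 * y $ 2 - x $ 2 * y $ 0) + x $ 0 * y $ 3 - x $ 3 * y $ 0"
  "r4' \<mu> lam x y $ 3 = x $ 2 * y $ 0 - x $ 0 * y $ 2 + lam * (x $ 0 * y $ 3 - x $ 3 * y $ 0)"
  by (simp_all add: r4'_def bracket_of_nth axis_def algebra_simps)

lemma R_r3'_nth:
  "R_r3' lam x y $ 0 = 0"
  "R_r3' lam x y $ 1 = 0"
  "R_r3' lam x y $ 2 = lam * (x $ 1 * y $ 2 - x $ 2 * y $ 1) + x $ 1 * y $ 3 - x $ 3 * y $ 1"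
  "R_r3' lam x y $ 3 = x $ 2 * y $ 1 - x $ 1 * y $ 2 + lam * (x $ 1 * y $ 3 - x $ 3 * y $ 1)"
  by (simp_all add: R_r3'_def bracket_of_nth axis_def algebra_simps)

lemma r4_nth:
  "r4 \<mu> lam x y $ 0 = 0"
  "r4 \<mu> lam x y $ 1 = x $ 0 * y $ 1 - x $ 1 * y $ 0"
  "r4 \<mu> lam x y $ 2 = \<mu> * (x $ 0 * y $ 2 - x $ 2 * y $ 0)"
  "r4 \<mu> lam x y $ 3 = lam * (x $ 0 * y $ 3 - x $ 3 * y $ 0)"
  by (simp_all add: r4_def bracket_of_nth axis_def algebra_simps)

lemma d4'0_nth:
  "d4'0 x y $ 0 = 0"
  "d4'0 x y $ 1 = x $ 0 * y $ 2 - x $ 2 * y $ 0"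
  "d4'0 x y $ 2 = x $ 1 * y $ 0 - x $ 0 * y $ 1"
  "d4'0 x y $ 3 = x $ 1 * y $ 2 - x $ 2 * y $ 1"
  by (simp_all add: d4'0_def bracket_of_nth axis_def algebra_simps)

lemma lie_bracket_bracket_of:
  assumes "\<And>x y z. br x (br y z) + br y (br z x) + br z (br x y) = 0" "br = bracket_of c"
  shows "lie_bracket br"
  using assms bilinear_bracket_of bracket_of_refl unfolding lie_bracket_def by auto

lemma lie_bracket_R_r31: "lie_bracket R_r31"
  by (rule lie_bracket_bracket_of[OF _ R_r31_def])
    (simp add: vec_eq_iff all_index R_r31_nth algebra_simps)

lemma lie_bracket_r41: "lie_bracket r41"
  by (rule lie_bracket_bracket_of[OF _ r41_def])
    (simp add: vec_eq_iff all_index r41_nth algebra_simps)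

lemma lie_bracket_r4': "lie_bracket (r4' \<mu> lam)"
  by (rule lie_bracket_bracket_of[OF _ r4'_def])
    (simp add: vec_eq_iff all_index r4'_nth algebra_simps)

lemma lie_bracket_R_r3': "lie_bracket (R_r3' lam)"
  by (rule lie_bracket_bracket_of[OF _ R_r3'_def])
    (simp add: vec_eq_iff all_index R_r3'_nth algebra_simps)

lemma lie_bracket_r4: "lie_bracket (r4 \<mu> lam)"
  by (rule lie_bracket_bracket_of[OF _ r4_def])
    (simp add: vec_eq_iff all_index r4_nth algebra_simps)

lemma lie_bracket_d4'0: "lie_bracket d4'0"
  by (rule lie_bracket_bracket_of[OF _ d4'0_def])
    (simp add: vec_eq_iff all_index d4'0_nth algebra_simps)

end

theory Submission
  imports Defs
begin

text \<open>A generalized complex structure of type 0 has an invertible block \<open>\<J>\<^sub>2\<close>, and integrability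
  on pairs of covectors says exactly that the inverse of \<open>\<J>\<^sub>2\<close> is a symplectic form. On each of the
  seven algebras, closedness kills enough of the coefficients of a 2-form to make it degenerate.

  For types 1 and 2, one pairs the basis vectors as \<open>{e\<^sub>a, e\<^sub>b}\<close> and \<open>{e\<^sub>c, e\<^sub>d}\<close>. The structure
  \<open>J_complex\<close> is induced by the complex structure \<open>e\<^sub>a \<mapsto> e\<^sub>b\<close>, \<open>e\<^sub>c \<mapsto> e\<^sub>d\<close>, and \<open>J_mixed\<close> combines
  a symplectic form on the first plane with a complex structure on the second one. For each
  algebra a suitable pairing makes them integrable.\<close>

section \<open>Structures of type zero are symplectic forms\<close>

text \<open>The cyclic condition is d\<omega> = 0 for the Chevalley-Eilenberg differential, up to
  sign.\<close>

definition symplectic_form :: "('a::euclidean_space \<Rightarrow> 'a \<Rightarrow> 'a) \<Rightarrow> ('a \<Rightarrow> 'a \<Rightarrow> real) \<Rightarrow> bool" where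
  "symplectic_form br \<omega> \<longleftrightarrow> bilinear \<omega> \<and> (\<forall>x y. \<omega> x y = - \<omega> y x) \<and>
     (\<forall>x. (\<forall>y. \<omega> x y = 0) \<longrightarrow> x = 0) \<and>
     (\<forall>x y z. \<omega> (br x y) z + \<omega> (br y z) x + \<omega> (br z x) y = 0)"

lemma symplectic_formD:
  assumes "symplectic_form br \<omega>"
  shows "\<omega> (br x y) z + \<omega> (br y z) x + \<omega> (br z x) y = 0" "\<omega> x y = - \<omega> y x" "\<omega> x x = 0"
    "\<omega> (x + y) z = \<omega> x z + \<omega> y z" "\<omega> (x - y) z = \<omega> x z - \<omega> y z" "\<omega> (- x) z = - \<omega> x z"
    "\<omega> (r *\<^sub>R x) z = r * \<omega> x z" "\<omega> 0 z = 0"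
proof -
  have bil: "bilinear \<omega>" using assms unfolding symplectic_form_def by blast
  have skew: "\<omega> x y = - \<omega> y x" for x y
    using assms unfolding symplectic_form_def by blast
  show "\<omega> (x + y) z = \<omega> x z + \<omega> y z" "\<omega> (x - y) z = \<omega> x z - \<omega> y z" "\<omega> (- x) z = - \<omega> x z"
    "\<omega> (r *\<^sub>R x) z = r * \<omega> x z" "\<omega> 0 z = 0"
    using bil
    by (simp_all add: bilinear_ladd bilinear_lsub bilinear_lneg bilinear_lmul bilinear_lzero)
  show "\<omega> x y = - \<omega> y x" by (rule skew)
  show "\<omega> x x = 0" using skew[of x x] by linarith
  show "\<omega> (br x y) z + \<omega> (br y z) x + \<omega> (br z x) y = 0"
    using assms unfolding symplectic_form_def by blast
qed

lemma linear_block2: "linear J \<Longrightarrow> linear (block2 J)"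
  unfolding block2_def
  by (rule linearI)
    (simp_all add: linear_add[of J, symmetric] linear_scale[of J, symmetric]
      flip: fst_add fst_scaleR)

text \<open>Orthogonality is applied to \<open>u\<close> and \<open>J v\<close>; then
  \<open>J (J v) = - v\<close> moves \<open>J\<close> across the pairing.\<close>

lemma gcs_pairing_skew:
  assumes "generalized_complex_structure br J"
  shows "pairing (J u) v = - pairing u (J v)"
proof -
  have "J (J v) = - v" "pairing (J u) (J (J v)) = pairing u (J v)"
    using assms unfolding generalized_complex_structure_def by blast+
  then show ?thesis
    by (simp add: pairing_def case_prod_unfold blinfun.minus_left blinfun.minus_right field_simps)
qed

text \<open>Against a covector the pairing sees only the vector component, so the skewness of
  \<open>J\<close> passes to this block, which is thus a bivector.\<close>

lemma gcs_block2_skew: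
  assumes "generalized_complex_structure br J"
  shows "blinfun_apply \<beta> (block2 J \<alpha>) = - blinfun_apply \<alpha> (block2 J \<beta>)"
  using gcs_pairing_skew[OF assms, of "(0, \<alpha>)" "(0, \<beta>)"]
  by (simp add: pairing_def block2_def case_prod_unfold)

text \<open>This is the vector component of the integrability condition on two covectors, whose double
  bracket vanishes.\<close>

lemma gcs_block2_bracket:
  assumes J: "generalized_complex_structure br J" and br: "bilinear br"
  shows "br (block2 J \<alpha>) (block2 J \<beta>) =
    block2 J (- (\<beta> o\<^sub>L ad br (block2 J \<alpha>)) + (\<alpha> o\<^sub>L ad br (block2 J \<beta>)))"
proof -
  let ?P = "block2 J"
  have lin: "linear J" using J by (simp add: generalized_complex_structure_def)
  have ad0: "ad br 0 = 0"
    by (rule blinfun_eqI) (simp add: blinfun_apply_ad[OF br] bilinear_lzero[OF br])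
  have [simp]: "br 0 x = 0" "br x 0 = 0" for x
    using bilinear_lzero[OF br] bilinear_rzero[OF br] by auto
  have z: "0 o\<^sub>L (A :: 'a \<Rightarrow>\<^sub>L 'a) = (0 :: 'a \<Rightarrow>\<^sub>L real)" for A
    by (rule blinfun_eqI) simp
  have z': "\<gamma> o\<^sub>L (0 :: 'a \<Rightarrow>\<^sub>L 'a) = 0" for \<gamma> :: "'a \<Rightarrow>\<^sub>L real"
    by (rule blinfun_eqI) (simp add: blinfun.zero_right)
  have "double_bracket br (0, \<alpha>) (0, \<beta>) + J (double_bracket br (J (0, \<alpha>)) (0, \<beta>))
      + J (double_bracket br (0, \<alpha>) (J (0, \<beta>))) - double_bracket br (J (0, \<alpha>)) (J (0, \<beta>)) = 0"
    using J unfolding generalized_complex_structure_def by blast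
  then have "fst (J (0, - (\<beta> o\<^sub>L ad br (?P \<alpha>)))) + fst (J (0, \<alpha> o\<^sub>L ad br (?P \<beta>)))
      - br (?P \<alpha>) (?P \<beta>) = 0"
    by (simp add: double_bracket_def case_prod_unfold block2_def ad0 z z' prod_eq_iff)
  then show ?thesis
    using linear_add[OF linear_block2[OF lin], of "- (\<beta> o\<^sub>L ad br (?P \<alpha>))"
        "\<alpha> o\<^sub>L ad br (?P \<beta>)"]
    by (simp add: block2_def)
qed

text \<open>The form is the inverse of \<open>block2 J\<close>: full rank makes the block bijective,
  its skewness carries over, and integrability becomes closedness.\<close>

lemma gcs_type_0_imp_symplectic:
  fixes br :: "'a::euclidean_space \<Rightarrow> 'a \<Rightarrow> 'a"
  assumes adm: "admits_gcs_of_type br 0" and br: "bilinear br" and skew: "\<And>x y. br x y = - br y x"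
  obtains \<omega> where "symplectic_form br \<omega>"
proof -
  obtain J where J: "generalized_complex_structure br J" and t: "has_type J 0"
    using adm by (auto simp: admits_gcs_of_type_def)
  define P where "P = block2 J"
  have lin: "linear P"
    using J by (simp add: P_def generalized_complex_structure_def linear_block2)
  have "dim (range P) = DIM('a)"
    using t by (auto simp: has_type_def P_def)
  then have "span (range P) = UNIV"
    by (simp only: dim_eq_full)
  then have surj: "surj P"
    by (metis lin linear_subspace_image span_eq_iff subspace_UNIV)
  have skewP: "blinfun_apply \<beta> (P \<alpha>) = - blinfun_apply \<alpha> (P \<beta>)" for \<alpha> \<beta>
    unfolding P_def by (rule gcs_block2_skew[OF J])
  \<comment> \<open>Skewness turns surjectivity into injectivity: covectors with equal images agree
    on the range of \<open>P\<close>, which is everything.\<close>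
  have P_eqD: "\<alpha> = \<beta>" if "P \<alpha> = P \<beta>" for \<alpha> \<beta>
  proof (rule blinfun_eqI)
    fix x
    obtain \<gamma> where "x = P \<gamma>" using surj by (metis surjD)
    then show "blinfun_apply \<alpha> x = blinfun_apply \<beta> x"
      using skewP[of \<alpha> \<gamma>] skewP[of \<beta> \<gamma>] that by simp
  qed
  define \<omega> where "\<omega> x = blinfun_apply (inv P x)" for x
  have P_inv: "P (inv P x) = x" for x
    by (simp add: surj surj_f_inv_f)
  have inv_add: "inv P (x + y) = inv P x + inv P y" for x y
    by (rule P_eqD) (simp add: P_inv linear_add[OF lin])
  have inv_scale: "inv P (c *\<^sub>R x) = c *\<^sub>R inv P x" for c x
    by (rule P_eqD) (simp add: P_inv linear_scale[OF lin])
  have bil: "bilinear \<omega>"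
    unfolding bilinear_def \<omega>_def
    by (auto intro!: linearI simp: inv_add inv_scale blinfun.add_left blinfun.add_right
        blinfun.scaleR_left blinfun.scaleR_right)
  have sk: "\<omega> x y = - \<omega> y x" for x y
    using skewP[of "inv P x" "inv P y"] by (simp add: \<omega>_def P_inv)
  have nondeg: "x = 0" if "\<forall>y. \<omega> x y = 0" for x
  proof -
    have "inv P x = 0" using that by (auto intro: blinfun_eqI simp: \<omega>_def)
    then show ?thesis using P_inv[of x] linear_0[OF lin] by simp
  qed
  \<comment> \<open>Injectivity of \<open>P\<close> strips the outer \<open>P\<close> from the
    bracket formula for two covectors.\<close>
  have closed: "\<omega> (br x y) z = - \<omega> y (br x z) + \<omega> x (br y z)" for x y z
  proof -
    have "inv P (br x y) = - (inv P y o\<^sub>L ad br x) + (inv P x o\<^sub>L ad br y)"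
      using gcs_block2_bracket[OF J br, of "inv P x" "inv P y"]
      by (intro P_eqD) (simp add: P_inv flip: P_def)
    then show ?thesis
      by (simp add: \<omega>_def blinfun.diff_left blinfun_apply_ad[OF br])
  qed
  have "\<omega> (br x y) z + \<omega> (br y z) x + \<omega> (br z x) y = 0" for x y z
  proof -
    have "\<omega> (br z x) y = \<omega> y (br x z)"
      using sk[of "br z x" y] skew[of z x] bilinear_rneg[OF bil, of y "br x z"] by simp
    then show ?thesis using closed[of x y z] sk[of x "br y z"] by simp
  qed
  then have "symplectic_form br \<omega>"
    unfolding symplectic_form_def using bil sk nondeg by blast
  then show thesis by (rule that)
qed

section \<open>Degenerate 2-forms in four dimensions\<close>

lemma linear_form_nth:
  fixes f :: "real^4 \<Rightarrow> real"
  assumes "linear f"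
  shows "f x = (\<Sum>i\<in>UNIV. x $ i * f (\<ee> i))"
proof -
  have "f x = f (\<Sum>i\<in>UNIV. x $ i *\<^sub>R \<ee> i)"
    by (simp add: basis_expansion scalar_mult_eq_scaleR[symmetric])
  then show ?thesis by (simp add: linear_sum[OF assms] linear_scale[OF assms])
qed

lemma symplectic_form_zero:
  fixes \<omega> :: "real^4 \<Rightarrow> real^4 \<Rightarrow> real"
  assumes "symplectic_form br \<omega>" "\<And>k. \<omega> x (\<ee> k) = 0"
  shows "x = 0"
proof -
  have "linear (\<omega> x)"
    using assms(1) unfolding symplectic_form_def bilinear_def by blast
  then have "\<omega> x y = 0" for y using linear_form_nth[of "\<omega> x" y] assms(2) by simp
  then show ?thesis using assms(1) unfolding symplectic_form_def by blast
qed

text \<open>The plane spanned by \<open>\<ee> i\<close> and \<open>\<ee> j\<close> would contain a nonzero vector of the radical of \<open>\<omega>\<close>,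
  namely one orthogonal to \<open>\<ee> m\<close>.\<close>

lemma not_symplectic_form:
  fixes \<omega> :: "real^4 \<Rightarrow> real^4 \<Rightarrow> real"
  assumes \<omega>: "symplectic_form br \<omega>" and ne: "i \<noteq> j"
    and i: "\<And>k. k \<noteq> m \<Longrightarrow> \<omega> (\<ee> i) (\<ee> k) = 0" and j: "\<And>k. k \<noteq> m \<Longrightarrow> \<omega> (\<ee> j) (\<ee> k) = 0"
  shows False
proof -
  let ?x = "\<omega> (\<ee> j) (\<ee> m) *\<^sub>R \<ee> i - \<omega> (\<ee> i) (\<ee> m) *\<^sub>R \<ee> j"
  have bil: "bilinear \<omega>" using \<omega> unfolding symplectic_form_def by blast
  have "\<omega> ?x (\<ee> k) = 0" for k
    using i[of k] j[of k]
    by (cases "k = m") (simp_all add: bilinear_lsub[OF bil] bilinear_lmul[OF bil])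
  then have "?x = 0" by (rule symplectic_form_zero[OF \<omega>])
  \<comment> \<open>As \<open>i \<noteq> j\<close>, this coordinate is
    \<open>\<omega> (\<ee> j) (\<ee> m)\<close>; once it vanishes, \<open>\<ee> j\<close> itself
    lies in the radical.\<close>
  then have "?x $ i = 0" by simp
  then have "\<omega> (\<ee> j) (\<ee> m) = 0" using ne by (simp add: axis_def)
  then have "\<omega> (\<ee> j) (\<ee> k) = 0" for k using j by (cases "k = m") auto
  then have "\<ee> j = 0" by (rule symplectic_form_zero[OF \<omega>])
  then show False by (simp add: axis_eq_0_iff)
qed

lemma bracket_of_skew: "bracket_of c x y = - bracket_of c y x"
  by (simp add: vec_eq_iff bracket_of_nth algebra_simps)

lemma not_type_0:
  assumes "br = bracket_of c" "\<And>\<omega>. symplectic_form br \<omega> \<Longrightarrow> False"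
  shows "\<not> admits_gcs_of_type br 0"
  using gcs_type_0_imp_symplectic[OF _ bilinear_bracket_of bracket_of_skew] assms by blast

section \<open>Structures built from two coordinate planes\<close>

definition covec :: "real^4 \<Rightarrow> ((real^4) \<Rightarrow>\<^sub>L real)" where
  "covec a = blinfun_inner_right a"

definition coords :: "((real^4) \<Rightarrow>\<^sub>L real) \<Rightarrow> real^4" where
  "coords \<alpha> = (\<chi> i. blinfun_apply \<alpha> (\<ee> i))"

lemma coords_nth: "coords \<alpha> $ i = blinfun_apply \<alpha> (\<ee> i)"
  by (simp add: coords_def)

lemma blinfun_apply_coords: "blinfun_apply \<alpha> x = coords \<alpha> \<bullet> x"
  using linear_form_nth[of "blinfun_apply \<alpha>" x]
  by (simp add: coords_nth inner_vec_def mult.commute bounded_linear.linear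
      blinfun.bounded_linear_right)

lemma covec_apply: "blinfun_apply (covec a) x = a \<bullet> x"
  by (simp add: covec_def)

lemma coords_covec [simp]: "coords (covec a) = a"
  by (simp add: vec_eq_iff coords_nth covec_apply inner_axis)

lemma covec_coords [simp]: "covec (coords \<alpha>) = \<alpha>"
  by (rule blinfun_eqI) (simp add: covec_apply flip: blinfun_apply_coords)

lemma coords_eq_iff: "coords \<alpha> = coords \<beta> \<longleftrightarrow> \<alpha> = \<beta>"
  by (metis covec_coords)

lemma coords_linear [simp]:
  "coords (\<alpha> + \<beta>) = coords \<alpha> + coords \<beta>" "coords (\<alpha> - \<beta>) = coords \<alpha> - coords \<beta>"
  "coords (- \<alpha>) = - coords \<alpha>" "coords (c *\<^sub>R \<alpha>) = c *\<^sub>R coords \<alpha>" "coords 0 = 0"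
  by (simp_all add: vec_eq_iff coords_nth blinfun.add_left blinfun.diff_left blinfun.minus_left
      blinfun.scaleR_left)

lemma coords_ad:
  "bilinear br \<Longrightarrow> coords (\<alpha> o\<^sub>L ad br x) $ k = coords \<alpha> \<bullet> br x (\<ee> k)"
  by (simp add: coords_nth blinfun_apply_ad blinfun_apply_coords[of \<alpha>])

text \<open>For distinct indices, the quarter turn of a coordinate plane, extended by zero to the
  other basis vectors.\<close>

definition rot :: "4 \<Rightarrow> 4 \<Rightarrow> real^4 \<Rightarrow> real^4" where
  "rot a b x = x $ a *\<^sub>R \<ee> b - x $ b *\<^sub>R \<ee> a"

lemma rot_linear:
  "rot a b (x + y) = rot a b x + rot a b y" "rot a b (c *\<^sub>R x) = c *\<^sub>R rot a b x"
  by (simp_all add: rot_def algebra_simps)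

text \<open>A complex structure acts on covectors by minus its transpose. Its matrix here is skew,
  so in dual coordinates the same rotations act on both components.\<close>

definition J_complex :: "4 \<Rightarrow> 4 \<Rightarrow> 4 \<Rightarrow> 4 \<Rightarrow> (real^4) double \<Rightarrow> (real^4) double" where
  "J_complex a b c d = (\<lambda>(x, \<alpha>).
     (rot a b x + rot c d x, covec (rot a b (coords \<alpha>) + rot c d (coords \<alpha>))))"

text \<open>On the first plane the symplectic form and minus its inverse exchange vectors and
  covectors. Both are \<open>rot a b\<close>, because a quarter turn squares to minus the
  identity.\<close>

definition J_mixed :: "4 \<Rightarrow> 4 \<Rightarrow> 4 \<Rightarrow> 4 \<Rightarrow> (real^4) double \<Rightarrow> (real^4) double" where
  "J_mixed a b c d = (\<lambda>(x, \<alpha>).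
     (rot a b (coords \<alpha>) + rot c d x, covec (rot a b x + rot c d (coords \<alpha>))))"

lemma rot_nth: "rot a b x $ k = (if k = b then x $ a else 0) - (if k = a then x $ b else 0)"
  by (simp add: rot_def axis_def)

lemma J_components:
  "fst (J_complex a b c d u) = rot a b (fst u) + rot c d (fst u)"
  "coords (snd (J_complex a b c d u)) = rot a b (coords (snd u)) + rot c d (coords (snd u))"
  "fst (J_mixed a b c d u) = rot a b (coords (snd u)) + rot c d (fst u)"
  "coords (snd (J_mixed a b c d u)) = rot a b (fst u) + rot c d (coords (snd u))"
  by (simp_all add: J_complex_def J_mixed_def case_prod_unfold)

lemma double_eq_iff: "u = v \<longleftrightarrow> fst u = fst v \<and> coords (snd u) = coords (snd v)"
  for u v :: "(real^4) double"
  by (simp add: prod_eq_iff coords_eq_iff)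

lemma linear_J: "linear (J_complex a b c d)" "linear (J_mixed a b c d)"
  by (auto intro!: linearI simp: double_eq_iff J_components rot_linear algebra_simps)

lemma UNIV_distinct: "distinct [a, b, c, d] \<Longrightarrow> (UNIV :: 4 set) = {a, b, c, d}"
  by (rule card_subset_eq[symmetric]) auto

lemma J_square:
  assumes "distinct [a, b, c, d]"
  shows "J_complex a b c d (J_complex a b c d u) = - u" "J_mixed a b c d (J_mixed a b c d u) = - u"
proof -
  have all: "(\<forall>k. Q k) \<longleftrightarrow> Q a \<and> Q b \<and> Q c \<and> Q d" for Q :: "4 \<Rightarrow> bool"
    using UNIV_distinct[OF assms] by (metis UNIV_I empty_iff insert_iff)
  show "J_complex a b c d (J_complex a b c d u) = - u" "J_mixed a b c d (J_mixed a b c d u) = - u"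
    using assms
    by (auto simp: double_eq_iff J_components vec_eq_iff all rot_nth)
qed

lemma pairing_coords:
  "pairing u v = (coords (snd v) \<bullet> fst u + coords (snd u) \<bullet> fst v) / 2"
  by (simp add: pairing_def case_prod_unfold blinfun_apply_coords)

text \<open>Quarter turns preserve the inner product on their planes, and exchanging vectors with
  covectors leaves the symmetric pairing unchanged.\<close>

lemma J_orthogonal:
  assumes "distinct [a, b, c, d]"
  shows "pairing (J_complex a b c d u) (J_complex a b c d v) = pairing u v"
    "pairing (J_mixed a b c d u) (J_mixed a b c d v) = pairing u v"
proof -
  have ne: "a \<noteq> b" "a \<noteq> c" "a \<noteq> d" "b \<noteq> c" "b \<noteq> d" "c \<noteq> d"
    using assms by auto
  have inner: "x \<bullet> y = x $ a * y $ a + x $ b * y $ b + x $ c * y $ c + x $ d * y $ d"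
    for x y :: "real^4"
    using assms by (simp add: inner_vec_def UNIV_distinct[OF assms])
  show "pairing (J_complex a b c d u) (J_complex a b c d v) = pairing u v"
    "pairing (J_mixed a b c d u) (J_mixed a b c d v) = pairing u v"
    using ne
    by (simp_all add: pairing_coords J_components inner rot_nth algebra_simps)
qed

lemma J_complex_type: "has_type (J_complex a b c d) 2"
proof -
  have "range (block2 (J_complex a b c d)) = {0}"
    by (auto simp: block2_def J_complex_def rot_def)
  then show ?thesis unfolding has_type_def by (intro exI[of _ 2]) simp
qed

lemma J_mixed_type:
  assumes "distinct [a, b, c, d]"
  shows "has_type (J_mixed a b c d) 1"
proof -
  have ne: "a \<noteq> b" "a \<noteq> c" "a \<noteq> d" "b \<noteq> c" "b \<noteq> d" "c \<noteq> d"
    using assms by auto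
  have "range (block2 (J_mixed a b c d)) = span {\<ee> a, \<ee> b}"
  proof
    show "range (block2 (J_mixed a b c d)) \<subseteq> span {\<ee> a, \<ee> b}"
    proof
      fix x
      assume "x \<in> range (block2 (J_mixed a b c d))"
      then obtain \<alpha> where "x = rot a b (coords \<alpha>)"
        by (auto simp: block2_def J_mixed_def rot_def)
      then show "x \<in> span {\<ee> a, \<ee> b}"
        by (simp add: rot_def span_diff span_scale span_base)
    qed
  next
    \<comment> \<open>The preimage works because \<open>rot b a\<close> is minus
      \<open>rot a b\<close>, hence its inverse on the plane.\<close>
    have "block2 (J_mixed a b c d) (covec (rot b a x)) = x" if x: "x \<in> span {\<ee> a, \<ee> b}" for x
    proof -
      obtain r s where "x - r *\<^sub>R \<ee> a = s *\<^sub>R \<ee> b"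
        using x by (auto simp: span_insert span_singleton)
      then have "x = r *\<^sub>R \<ee> a + s *\<^sub>R \<ee> b" by (simp add: algebra_simps)
      then show ?thesis
        using ne by (simp add: block2_def J_mixed_def vec_eq_iff rot_nth axis_def)
    qed
    then show "span {\<ee> a, \<ee> b} \<subseteq> range (block2 (J_mixed a b c d))"
      by (metis rangeI subsetI)
  qed
  moreover have "independent {\<ee> a, \<ee> b}"
    by (rule independent_mono[OF independent_Basis]) (auto simp: Basis_vec_def)
  then have "dim (span {\<ee> a, \<ee> b}) = 2"
    using assms by (simp add: dim_eq_card_independent axis_eq_axis)
  ultimately show ?thesis unfolding has_type_def by (intro exI[of _ 2]) simp
qed

text \<open>Only integrability involves the bracket, so it is the one condition left to check on
  each algebra.\<close>

lemma admits_type_2: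
  assumes "distinct [a, b, c, d]"
    and "\<And>u v. double_bracket br u v + J_complex a b c d (double_bracket br (J_complex a b c d u) v)
          + J_complex a b c d (double_bracket br u (J_complex a b c d v))
          - double_bracket br (J_complex a b c d u) (J_complex a b c d v) = 0"
  shows "admits_gcs_of_type br 2"
  unfolding admits_gcs_of_type_def generalized_complex_structure_def
  by (intro exI[of _ "J_complex a b c d"] conjI allI linear_J J_square[OF assms(1)]
      J_orthogonal[OF assms(1)] assms(2) J_complex_type)

lemma admits_type_1:
  assumes "distinct [a, b, c, d]"
    and "\<And>u v. double_bracket br u v + J_mixed a b c d (double_bracket br (J_mixed a b c d u) v)
          + J_mixed a b c d (double_bracket br u (J_mixed a b c d v))
          - double_bracket br (J_mixed a b c d u) (J_mixed a b c d v) = 0"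
  shows "admits_gcs_of_type br 1"
  unfolding admits_gcs_of_type_def generalized_complex_structure_def
  by (intro exI[of _ "J_mixed a b c d"] conjI allI linear_J J_square[OF assms(1)]
      J_orthogonal[OF assms(1)] assms(2) J_mixed_type[OF assms(1)])

section \<open>Integrability in coordinates\<close>

lemma fst_double_bracket: "fst (double_bracket br u v) = br (fst u) (fst v)"
  by (simp add: double_bracket_def case_prod_unfold)

lemma coords_double_bracket:
  assumes "lie_bracket br"
  shows "coords (snd (double_bracket br u v)) $ k =
    coords (snd u) \<bullet> br (fst v) (\<ee> k) - coords (snd v) \<bullet> br (fst u) (\<ee> k)"
proof -
  have bil: "bilinear br" using assms by (simp add: lie_bracket_def)
  show ?thesis
    by (simp add: double_bracket_def case_prod_unfold coords_ad[OF bil])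
qed

lemma inner_index: "x \<bullet> y = x $ 0 * y $ 0 + x $ 1 * y $ 1 + x $ 2 * y $ 2 + x $ 3 * y $ (3::4)"
  for x y :: "real^4"
  by (simp add: inner_vec_def sum_index)

text \<open>These rewrite integrability into eight polynomial identities in the sixteen coordinates
  of \<open>u\<close> and \<open>v\<close>.\<close>

lemmas integrability_simps = double_eq_iff vec_eq_iff all_index fst_double_bracket
  coords_double_bracket J_components rot_nth inner_index axis_def

text \<open>\<open>\<ee> 1\<close> acts as the identity on the plane of \<open>\<ee> 2\<close> and
  \<open>\<ee> 3\<close>, hence commutes with its rotation.\<close>

lemma admits_R_r31: "admits_gcs_of_type R_r31 1" "admits_gcs_of_type R_r31 2"
  by (rule admits_type_1[of 0 1 2 3], simp,
      simp add: integrability_simps lie_bracket_R_r31 R_r31_nth algebra_simps)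
    (rule admits_type_2[of 0 1 2 3], simp,
      simp add: integrability_simps lie_bracket_R_r31 R_r31_nth algebra_simps)

text \<open>The Jordan block on \<open>\<ee> 2\<close>, \<open>\<ee> 3\<close> leads to different
  second planes: for type 1, \<open>\<ee> 0\<close> acts on \<open>\<ee> 1\<close>,
  \<open>\<ee> 3\<close> as the identity modulo \<open>\<ee> 2\<close>; for type 2, it is the
  identity on \<open>\<ee> 1\<close>, \<open>\<ee> 2\<close>.\<close>

lemma admits_r41: "admits_gcs_of_type r41 1" "admits_gcs_of_type r41 2"
  by (rule admits_type_1[of 0 2 1 3], simp,
      simp add: integrability_simps lie_bracket_r41 r41_nth algebra_simps)
    (rule admits_type_2[of 0 3 1 2], simp,
      simp add: integrability_simps lie_bracket_r41 r41_nth algebra_simps)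

text \<open>\<open>\<ee> 0\<close> acts on the second plane by a scalar plus a rotation, which
  commutes with \<open>rot 2 3\<close>.\<close>

lemma admits_r4': "admits_gcs_of_type (r4' \<mu> lam) 1" "admits_gcs_of_type (r4' \<mu> lam) 2"
  by (rule admits_type_1[of 0 1 2 3], simp,
      simp add: integrability_simps lie_bracket_r4' r4'_nth algebra_simps)
    (rule admits_type_2[of 0 1 2 3], simp,
      simp add: integrability_simps lie_bracket_r4' r4'_nth algebra_simps)

lemma admits_R_r3': "admits_gcs_of_type (R_r3' lam) 1" "admits_gcs_of_type (R_r3' lam) 2"
  by (rule admits_type_1[of 0 1 2 3], simp,
      simp add: integrability_simps lie_bracket_R_r3' R_r3'_nth algebra_simps)
    (rule admits_type_2[of 0 1 2 3], simp,
      simp add: integrability_simps lie_bracket_R_r3' R_r3'_nth algebra_simps)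

lemma admits_r4_diag: "admits_gcs_of_type (r4 \<mu> \<mu>) 1" "admits_gcs_of_type (r4 \<mu> \<mu>) 2"
  by (rule admits_type_1[of 0 1 2 3], simp,
      simp add: integrability_simps lie_bracket_r4 r4_nth algebra_simps)
    (rule admits_type_2[of 0 1 2 3], simp,
      simp add: integrability_simps lie_bracket_r4 r4_nth algebra_simps)

text \<open>The equal eigenvalues now belong to \<open>\<ee> 1\<close> and \<open>\<ee> 3\<close>,
  so these span the second plane.\<close>

lemma admits_r4_one: "admits_gcs_of_type (r4 \<mu> 1) 1" "admits_gcs_of_type (r4 \<mu> 1) 2"
  by (rule admits_type_1[of 0 2 1 3], simp,
      simp add: integrability_simps lie_bracket_r4 r4_nth algebra_simps)
    (rule admits_type_2[of 0 2 1 3], simp,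
      simp add: integrability_simps lie_bracket_r4 r4_nth algebra_simps)

text \<open>\<open>\<ee> 0\<close> rotates the plane of \<open>\<ee> 1\<close> and
  \<open>\<ee> 2\<close>, so this plane carries the complex part; the central \<open>\<ee> 3\<close>
  is paired with \<open>\<ee> 0\<close>.\<close>

lemma admits_d4'0: "admits_gcs_of_type d4'0 1" "admits_gcs_of_type d4'0 2"
  by (rule admits_type_1[of 0 3 1 2], simp,
      simp add: integrability_simps lie_bracket_d4'0 d4'0_nth algebra_simps)
    (rule admits_type_2[of 0 3 1 2], simp,
      simp add: integrability_simps lie_bracket_d4'0 d4'0_nth algebra_simps)

section \<open>Nonexistence of symplectic forms\<close>

lemma add_mult_zero: "r * p + s * p = 0 \<Longrightarrow> r + s \<noteq> 0 \<Longrightarrow> p = 0"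
  for p r s :: real
  by (simp flip: distrib_right)

text \<open>The system has determinant \<open>m * m + 1\<close>, which is positive. It arises from
  closedness when the adjoint action contains a rotation.\<close>

lemma rotation_zero:
  fixes m p q :: real
  assumes "m * p = q" "p + m * q = 0"
  shows "p = 0" "q = 0"
proof -
  have "p * (1 + m * m) = 0" using assms by (simp add: algebra_simps)
  then show "p = 0" by (smt (verit) mult_eq_0_iff zero_le_square)
  then show "q = 0" using assms by simp
qed

text \<open>Closedness leaves \<open>\<ee> 2\<close> and \<open>\<ee> 3\<close> paired with
  \<open>\<ee> 1\<close> only.\<close>

lemma not_type_0_R_r31: "\<not> admits_gcs_of_type R_r31 0"
proof (rule not_type_0[OF R_r31_def])
  fix \<omega>
  assume \<omega>: "symplectic_form R_r31 \<omega>"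
  note simps = symplectic_formD(3-8)[OF \<omega>]
  note skew = symplectic_formD(2)[OF \<omega>]
  note closed = symplectic_formD(1)[OF \<omega>, of "\<ee> 0" "\<ee> 1" "\<ee> 2"]
    symplectic_formD(1)[OF \<omega>, of "\<ee> 0" "\<ee> 1" "\<ee> 3"]
    symplectic_formD(1)[OF \<omega>, of "\<ee> 1" "\<ee> 2" "\<ee> 3"]
  have zero: "\<omega> (\<ee> 0) (\<ee> 2) = 0" "\<omega> (\<ee> 0) (\<ee> 3) = 0" "\<omega> (\<ee> 2) (\<ee> 3) = 0"
    using closed skew[of "\<ee> 2" "\<ee> 0"] skew[of "\<ee> 3" "\<ee> 0"] skew[of "\<ee> 3" "\<ee> 2"]
    by (simp_all add: R_r31_def bracket_of_basis simps)
  have "\<forall>k. k \<noteq> 1 \<longrightarrow> \<omega> (\<ee> 2) (\<ee> k) = 0 \<and> \<omega> (\<ee> 3) (\<ee> k) = 0"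
    using zero skew[of "\<ee> 2" "\<ee> 0"] skew[of "\<ee> 3" "\<ee> 0"] skew[of "\<ee> 3" "\<ee> 2"]
    by (simp add: all_index simps)
  then show False
    using not_symplectic_form[OF \<omega>, of 2 3 1] by simp
qed

text \<open>On the abelian ideal of \<open>\<ee> 1\<close>, \<open>\<ee> 2\<close>,
  \<open>\<ee> 3\<close> closedness says that the action of \<open>\<ee> 0\<close> annihilates the
  form. Its only eigenvalue on 2-forms there is 2 up to sign, so the restriction vanishes.\<close>

lemma not_type_0_r41: "\<not> admits_gcs_of_type r41 0"
proof (rule not_type_0[OF r41_def])
  fix \<omega>
  assume \<omega>: "symplectic_form r41 \<omega>"
  note simps = symplectic_formD(3-8)[OF \<omega>]
  note skew = symplectic_formD(2)[OF \<omega>]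
  note closed = symplectic_formD(1)[OF \<omega>, of "\<ee> 0" "\<ee> 1" "\<ee> 2"]
    symplectic_formD(1)[OF \<omega>, of "\<ee> 0" "\<ee> 1" "\<ee> 3"]
    symplectic_formD(1)[OF \<omega>, of "\<ee> 0" "\<ee> 2" "\<ee> 3"]
  have zero: "\<omega> (\<ee> 1) (\<ee> 2) = 0" "\<omega> (\<ee> 1) (\<ee> 3) = 0" "\<omega> (\<ee> 2) (\<ee> 3) = 0"
    using closed skew[of "\<ee> 2" "\<ee> 1"] skew[of "\<ee> 3" "\<ee> 1"] skew[of "\<ee> 3" "\<ee> 2"]
    by (simp_all add: r41_def bracket_of_basis simps)
  have "\<forall>k. k \<noteq> 0 \<longrightarrow> \<omega> (\<ee> 1) (\<ee> k) = 0 \<and> \<omega> (\<ee> 2) (\<ee> k) = 0"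
    using zero skew[of "\<ee> 2" "\<ee> 1"] skew[of "\<ee> 3" "\<ee> 1"] skew[of "\<ee> 3" "\<ee> 2"]
    by (simp add: all_index simps)
  then show False
    using not_symplectic_form[OF \<omega>, of 1 2 0] by simp
qed

text \<open>The trace \<open>2 * lam\<close> on the rotated plane kills
  \<open>\<omega> (\<ee> 2) (\<ee> 3)\<close>; a rotation system with \<open>m = \<mu> + lam\<close>
  kills the products with \<open>\<ee> 1\<close>.\<close>

lemma not_type_0_r4':
  assumes "lam \<noteq> 0"
  shows "\<not> admits_gcs_of_type (r4' \<mu> lam) 0"
proof (rule not_type_0[OF r4'_def])
  fix \<omega>
  assume \<omega>: "symplectic_form (r4' \<mu> lam) \<omega>"
  note simps = symplectic_formD(3-8)[OF \<omega>]
  note skew = symplectic_formD(2)[OF \<omega>]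
  note closed = symplectic_formD(1)[OF \<omega>, of "\<ee> 0" "\<ee> 1" "\<ee> 2"]
    symplectic_formD(1)[OF \<omega>, of "\<ee> 0" "\<ee> 1" "\<ee> 3"]
    symplectic_formD(1)[OF \<omega>, of "\<ee> 0" "\<ee> 2" "\<ee> 3"]
  have zero: "\<omega> (\<ee> 1) (\<ee> 2) = 0" "\<omega> (\<ee> 1) (\<ee> 3) = 0" "\<omega> (\<ee> 2) (\<ee> 3) = 0"
    using closed skew[of "\<ee> 2" "\<ee> 1"] skew[of "\<ee> 3" "\<ee> 1"] skew[of "\<ee> 3" "\<ee> 2"]
      rotation_zero[of "\<mu> + lam" "\<omega> (\<ee> 1) (\<ee> 2)" "\<omega> (\<ee> 1) (\<ee> 3)"]
    by (simp_all add: assms r4'_def bracket_of_basis simps algebra_simps)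
  have "\<forall>k. k \<noteq> 0 \<longrightarrow> \<omega> (\<ee> 2) (\<ee> k) = 0 \<and> \<omega> (\<ee> 3) (\<ee> k) = 0"
    using zero skew[of "\<ee> 2" "\<ee> 1"] skew[of "\<ee> 3" "\<ee> 1"] skew[of "\<ee> 3" "\<ee> 2"]
    by (simp add: all_index simps)
  then show False
    using not_symplectic_form[OF \<omega>, of 2 3 0] by simp
qed

lemma not_type_0_R_r3':
  assumes "lam \<noteq> 0"
  shows "\<not> admits_gcs_of_type (R_r3' lam) 0"
proof (rule not_type_0[OF R_r3'_def])
  fix \<omega>
  assume \<omega>: "symplectic_form (R_r3' lam) \<omega>"
  note simps = symplectic_formD(3-8)[OF \<omega>]
  note skew = symplectic_formD(2)[OF \<omega>]
  note closed = symplectic_formD(1)[OF \<omega>, of "\<ee> 0" "\<ee> 1" "\<ee> 2"]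
    symplectic_formD(1)[OF \<omega>, of "\<ee> 0" "\<ee> 1" "\<ee> 3"]
    symplectic_formD(1)[OF \<omega>, of "\<ee> 1" "\<ee> 2" "\<ee> 3"]
  have zero: "\<omega> (\<ee> 0) (\<ee> 2) = 0" "\<omega> (\<ee> 0) (\<ee> 3) = 0" "\<omega> (\<ee> 2) (\<ee> 3) = 0"
    using closed skew[of "\<ee> 2" "\<ee> 0"] skew[of "\<ee> 3" "\<ee> 0"] skew[of "\<ee> 3" "\<ee> 2"]
      rotation_zero[of lam "\<omega> (\<ee> 0) (\<ee> 2)" "\<omega> (\<ee> 0) (\<ee> 3)"]
    by (simp_all add: assms R_r3'_def bracket_of_basis simps algebra_simps)
  have "\<forall>k. k \<noteq> 1 \<longrightarrow> \<omega> (\<ee> 2) (\<ee> k) = 0 \<and> \<omega> (\<ee> 3) (\<ee> k) = 0"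
    using zero skew[of "\<ee> 2" "\<ee> 0"] skew[of "\<ee> 3" "\<ee> 0"] skew[of "\<ee> 3" "\<ee> 2"]
    by (simp add: all_index simps)
  then show False
    using not_symplectic_form[OF \<omega>, of 2 3 1] by simp
qed

text \<open>Closedness multiplies each product of two eigenvectors in the ideal by the sum of their
  eigenvalues; the hypotheses make all three sums nonzero.\<close>

lemma not_type_0_r4:
  assumes "1 + \<mu> \<noteq> 0" "1 + lam \<noteq> 0" "\<mu> + lam \<noteq> 0"
  shows "\<not> admits_gcs_of_type (r4 \<mu> lam) 0"
proof (rule not_type_0[OF r4_def])
  fix \<omega>
  assume \<omega>: "symplectic_form (r4 \<mu> lam) \<omega>"
  note simps = symplectic_formD(3-8)[OF \<omega>]
  note skew = symplectic_formD(2)[OF \<omega>]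
  note closed = symplectic_formD(1)[OF \<omega>, of "\<ee> 0" "\<ee> 1" "\<ee> 2"]
    symplectic_formD(1)[OF \<omega>, of "\<ee> 0" "\<ee> 1" "\<ee> 3"]
    symplectic_formD(1)[OF \<omega>, of "\<ee> 0" "\<ee> 2" "\<ee> 3"]
  have zero: "\<omega> (\<ee> 1) (\<ee> 2) = 0" "\<omega> (\<ee> 1) (\<ee> 3) = 0" "\<omega> (\<ee> 2) (\<ee> 3) = 0"
    using closed skew[of "\<ee> 2" "\<ee> 1"] skew[of "\<ee> 3" "\<ee> 1"] skew[of "\<ee> 3" "\<ee> 2"]
      add_mult_zero[of 1 "\<omega> (\<ee> 1) (\<ee> 2)" \<mu>] add_mult_zero[of 1 "\<omega> (\<ee> 1) (\<ee> 3)" lam]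
      add_mult_zero[of \<mu> "\<omega> (\<ee> 2) (\<ee> 3)" lam]
    by (simp_all add: assms r4_def bracket_of_basis simps)
  have "\<forall>k. k \<noteq> 0 \<longrightarrow> \<omega> (\<ee> 2) (\<ee> k) = 0 \<and> \<omega> (\<ee> 3) (\<ee> k) = 0"
    using zero skew[of "\<ee> 2" "\<ee> 1"] skew[of "\<ee> 3" "\<ee> 1"] skew[of "\<ee> 3" "\<ee> 2"]
    by (simp add: all_index simps)
  then show False
    using not_symplectic_form[OF \<omega>, of 2 3 0] by simp
qed

text \<open>Here a single vector suffices: closedness puts the central \<open>\<ee> 3\<close> into
  the radical.\<close>

lemma not_type_0_d4'0: "\<not> admits_gcs_of_type d4'0 0"
proof (rule not_type_0[OF d4'0_def])
  fix \<omega>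
  assume \<omega>: "symplectic_form d4'0 \<omega>"
  note simps = symplectic_formD(3-8)[OF \<omega>]
  note skew = symplectic_formD(2)[OF \<omega>]
  note closed = symplectic_formD(1)[OF \<omega>, of "\<ee> 0" "\<ee> 1" "\<ee> 2"]
    symplectic_formD(1)[OF \<omega>, of "\<ee> 0" "\<ee> 1" "\<ee> 3"]
    symplectic_formD(1)[OF \<omega>, of "\<ee> 0" "\<ee> 2" "\<ee> 3"]
  have "\<omega> (\<ee> 3) (\<ee> 0) = 0" "\<omega> (\<ee> 1) (\<ee> 3) = 0" "\<omega> (\<ee> 2) (\<ee> 3) = 0"
    using closed by (simp_all add: d4'0_def bracket_of_basis simps)
  then have "\<forall>k. \<omega> (\<ee> 3) (\<ee> k) = 0"
    using skew[of "\<ee> 3" "\<ee> 1"] skew[of "\<ee> 3" "\<ee> 2"] by (simp add: all_index simps)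
  then show False
    using symplectic_form_zero[OF \<omega>, of "\<ee> 3"] by (simp add: axis_eq_0_iff)
qed

theorem proposition5p3:
  "\<forall>\<gg> \<in> {R_r31} \<union> {r41}
       \<union> {r4' \<mu> lam | \<mu> lam. \<mu> > 0 \<and> lam \<noteq> 0}
       \<union> {R_r3' lam | lam. lam \<noteq> 0}
       \<union> {r4 \<mu> \<mu> | \<mu>. -1 < \<mu> \<and> \<mu> \<le> 1 \<and> \<mu> \<noteq> 0}
       \<union> {r4 \<mu> 1 | \<mu>. -1 < \<mu> \<and> \<mu> \<le> 1 \<and> \<mu> \<noteq> 0}
       \<union> {d4'0}.
     admits_gcs_of_type \<gg> 1 \<and> admits_gcs_of_type \<gg> 2 \<and> \<not> admits_gcs_of_type \<gg> 0"
proof -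
  \<comment> \<open>The eigenvalue sums are \<open>1 + \<mu>\<close>, nonzero by the lower bound,
    and \<open>\<mu> + \<mu>\<close>, nonzero since \<open>\<mu> \<noteq> 0\<close>.\<close>
  have "admits_gcs_of_type (r4 \<mu> \<mu>) 1 \<and> admits_gcs_of_type (r4 \<mu> \<mu>) 2 \<and>
      \<not> admits_gcs_of_type (r4 \<mu> \<mu>) 0"
    if "-1 < \<mu>" "\<mu> \<noteq> 0" for \<mu> :: real
    using that by (simp add: admits_r4_diag not_type_0_r4 del: One_nat_def)
  moreover have "admits_gcs_of_type (r4 \<mu> 1) 1 \<and> admits_gcs_of_type (r4 \<mu> 1) 2 \<and>
      \<not> admits_gcs_of_type (r4 \<mu> 1) 0"
    if "-1 < \<mu>" for \<mu> :: real
    using that by (simp add: admits_r4_one not_type_0_r4 del: One_nat_def)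
  \<comment> \<open>Deleting \<open>One_nat_def\<close> keeps the type index 1 in the form used by
    the existence lemmas.\<close>
  ultimately show ?thesis
    by (auto simp: admits_R_r31 admits_r41 admits_r4' admits_R_r3' admits_d4'0
        not_type_0_R_r31
        not_type_0_r41 not_type_0_r4' not_type_0_R_r3' not_type_0_d4'0
      simp del: One_nat_def)
qed

end
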